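(* Let $X$ be an uncountable set and let $\mathcal{B}$ and $\mathcal{D}$ be countably separated $\sigma$-algebras on $X$ such that $\mathcal{B}\cap\mathcal{D}$ is not countably separated. Then $$\big((\mathcal{D}\vee\mathcal{B})\otimes\mathcal{B}\big)\cap\big((\mathcal{D}\vee\mathcal{B})\otimes\mathcal{D}\big)\neq(\mathcal{D}\vee\mathcal{B})\otimes(\mathcal{D}\cap\mathcal{B}).$$
   Context: For $\sigma$-algebras $\mathcal{C}$ on a set $Y$ and $\mathcal{D}$ on a set $Z$, the product $\mathcal{C}\otimes\mathcal{D}$ is the smallest $\sigma$-algebra on $Y\times Z$ containing all rectangles $C\times D$ with $C\in\mathcal{C}$, $D\in\mathcal{D}$. For two $\sigma$-algebras on the same set, $\mathcal{D}\vee\mathcal{B}$ denotes the smallest $\sigma$-algebra containing both. A $\sigma$-algebra $\mathcal{C}$ on a set $Y$ is countably separated if there is a countable family $\{A_i: i\in I\}\subseteq\mathcal{C}$ (a countable separator) such that for any two distinct points $x,y\in Y$ there is $i\in I$ with $x\in A_i$ and $y\notin A_i$. *)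

theory Defs
  imports "HOL-Analysis.Sigma_Algebra"
begin

definition countable_separator :: "'a set \<Rightarrow> 'a set set \<Rightarrow> 'a set set \<Rightarrow> bool" where
  "countable_separator Y \<C> \<A> \<longleftrightarrow>
     countable \<A> \<and> \<A> \<subseteq> \<C> \<and>
     (\<forall>x\<in>Y. \<forall>y\<in>Y. x \<noteq> y \<longrightarrow> (\<exists>A\<in>\<A>. x \<in> A \<and> y \<notin> A))"

definition countably_separated :: "'a set \<Rightarrow> 'a set set \<Rightarrow> bool" where
  "countably_separated Y \<C> \<longleftrightarrow> (\<exists>\<A>. countable_separator Y \<C> \<A>)"

text \<open>The two carriers are explicit arguments because a \<open>\<sigma>\<close>-algebra is
  represented here by its family of sets alone.\<close>

definition prod_sigma ::
  "'a set \<Rightarrow> 'a set set \<Rightarrow> 'b set \<Rightarrow> 'b set set \<Rightarrow> ('a \<times> 'b) set set" where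
  "prod_sigma Y \<C> Z \<D> = sigma_sets (Y \<times> Z) {C \<times> D | C D. C \<in> \<C> \<and> D \<in> \<D>}"

definition join_sigma :: "'a set \<Rightarrow> 'a set set \<Rightarrow> 'a set set \<Rightarrow> 'a set set" where
  "join_sigma Y \<D> \<B> = sigma_sets Y (\<D> \<union> \<B>)"

end

theory Submission
  imports Defs
begin

text \<open>The diagonal of \<open>X\<close> distinguishes the two sides. A countable separator \<open>\<A>\<close> of a
  \<open>\<sigma>\<close>-algebra writes the complement of the diagonal as the countable union of the rectangles
  \<open>A \<times> (X - A)\<close>, so the diagonal lies in both products on the left. Conversely, a set in a product
  \<open>\<sigma>\<close>-algebra depends on its second coordinate only through countably many measurable sets; for
  the diagonal these sets, with their complements, form a countable separator.\<close>

text \<open>The first factor is a larger family \<open>\<E>\<close> so that one choice, the join,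
  serves for both \<open>\<B>\<close> and \<open>\<D>\<close>; the inclusion places the side
  \<open>A\<close> of each rectangle in \<open>\<E>\<close>, while \<open>X - A\<close> stays in
  \<open>\<C>\<close>.\<close>

lemma diagonal_in_prod_sigma:
  assumes "sigma_algebra X \<C>" and "countably_separated X \<C>" and "\<C> \<subseteq> \<E>"
  shows "Id_on X \<in> prod_sigma X \<E> X \<C>"
proof -
  interpret \<C>: sigma_algebra X \<C> by fact
  obtain \<A> where "countable_separator X \<C> \<A>"
    using assms(2) unfolding countably_separated_def by (elim exE)
  then have "countable \<A>" "\<A> \<subseteq> \<C>"
    and sep: "\<And>x y. x \<in> X \<Longrightarrow> y \<in> X \<Longrightarrow> x \<noteq> y \<Longrightarrow> \<exists>A\<in>\<A>. x \<in> A \<and> y \<notin> A"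
    unfolding countable_separator_def by simp_all
  have rect: "A \<times> (X - A) \<in> prod_sigma X \<E> X \<C>" if "A \<in> \<A>" for A
    unfolding prod_sigma_def using that \<open>\<A> \<subseteq> \<C>\<close> \<open>\<C> \<subseteq> \<E>\<close> \<C>.compl_sets
    by (intro sigma_sets.Basic) blast
  have "\<Union>((\<lambda>A. A \<times> (X - A)) ` \<A>) \<in> prod_sigma X \<E> X \<C>"
    unfolding prod_sigma_def
    by (rule sigma_sets_UNION) (use \<open>countable \<A>\<close> rect in \<open>auto simp: prod_sigma_def\<close>)
  then have "X \<times> X - (\<Union>A\<in>\<A>. A \<times> (X - A)) \<in> prod_sigma X \<E> X \<C>"
    unfolding prod_sigma_def by (rule sigma_sets.Compl)
  also have "X \<times> X - (\<Union>A\<in>\<A>. A \<times> (X - A)) = Id_on X"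
  proof (intro equalityI subsetI)
    fix p assume "p \<in> X \<times> X - (\<Union>A\<in>\<A>. A \<times> (X - A))"
    then show "p \<in> Id_on X" using sep[of "fst p" "snd p"] by (cases p) auto
  qed auto
  finally show ?thesis .
qed

text \<open>Induction on the generation of \<open>S\<close>: a rectangle \<open>C \<times> D\<close>
  needs only \<open>{D}\<close>, a complement keeps the family of the original set, and a countable
  union takes the union of the families.\<close>

lemma prod_sigma_countable_dependence:
  assumes "S \<in> prod_sigma Y \<C> Z \<D>"
  shows "\<exists>\<A>. countable \<A> \<and> \<A> \<subseteq> \<D> \<and>
    (\<forall>x\<in>Y. \<forall>y\<in>Z. \<forall>z\<in>Z. (\<forall>A\<in>\<A>. y \<in> A \<longleftrightarrow> z \<in> A) \<longrightarrow> ((x, y) \<in> S \<longleftrightarrow> (x, z) \<in> S))"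
  using assms unfolding prod_sigma_def
proof (induction rule: sigma_sets.induct)
  case (Basic S)
  then obtain C D where "S = C \<times> D" "D \<in> \<D>" by blast
  then show ?case by (intro exI[of _ "{D}"]) auto
next
  case Empty
  show ?case by (intro exI[of _ "{}"]) auto
next
  case (Compl S)
  then obtain \<A> where "countable \<A>" "\<A> \<subseteq> \<D>"
    and dep: "\<forall>x\<in>Y. \<forall>y\<in>Z. \<forall>z\<in>Z. (\<forall>A\<in>\<A>. y \<in> A \<longleftrightarrow> z \<in> A) \<longrightarrow>
      ((x, y) \<in> S \<longleftrightarrow> (x, z) \<in> S)"
    by blast
  show ?case
  proof (intro exI[of _ \<A>] conjI ballI impI)
    fix x y z
    assume "x \<in> Y" "y \<in> Z" "z \<in> Z" "\<forall>A\<in>\<A>. y \<in> A \<longleftrightarrow> z \<in> A"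
    \<comment> \<open>Both points lie in \<open>Y \<times> Z\<close>, so the complement
      distinguishes them only if \<open>S\<close> does.\<close>
    moreover from this have "(x, y) \<in> S \<longleftrightarrow> (x, z) \<in> S"
      by (intro dep[rule_format]) simp_all
    ultimately show "(x, y) \<in> Y \<times> Z - S \<longleftrightarrow> (x, z) \<in> Y \<times> Z - S" by simp
  qed fact+
next
  case (Union S)
  have "\<forall>i. \<exists>\<A>. countable \<A> \<and> \<A> \<subseteq> \<D> \<and>
    (\<forall>x\<in>Y. \<forall>y\<in>Z. \<forall>z\<in>Z. (\<forall>A\<in>\<A>. y \<in> A \<longleftrightarrow> z \<in> A) \<longrightarrow> ((x, y) \<in> S i \<longleftrightarrow> (x, z) \<in> S i))"
    by (rule allI) (rule Union.IH)
  from choice[OF this] obtain \<A> where \<A>: "\<forall>i. countable (\<A> i) \<and> \<A> i \<subseteq> \<D> \<and>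
    (\<forall>x\<in>Y. \<forall>y\<in>Z. \<forall>z\<in>Z. (\<forall>A\<in>\<A> i. y \<in> A \<longleftrightarrow> z \<in> A) \<longrightarrow> ((x, y) \<in> S i \<longleftrightarrow> (x, z) \<in> S i))"
    by (elim exE)
  show ?case
  proof (intro exI[of _ "\<Union>i. \<A> i"] conjI ballI impI)
    show "countable (\<Union>i. \<A> i)" using \<A> by (intro countable_UN) blast+
    show "(\<Union>i. \<A> i) \<subseteq> \<D>" using \<A> by blast
    fix x y z
    assume "x \<in> Y" "y \<in> Z" "z \<in> Z" "\<forall>A\<in>\<Union>i. \<A> i. y \<in> A \<longleftrightarrow> z \<in> A"
    then have "(x, y) \<in> S i \<longleftrightarrow> (x, z) \<in> S i" for i
      by (intro \<A>[rule_format, THEN conjunct2, THEN conjunct2, rule_format]) simp_all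
    then show "(x, y) \<in> (\<Union>i. S i) \<longleftrightarrow> (x, z) \<in> (\<Union>i. S i)" by blast
  qed
qed

text \<open>The section of the diagonal at \<open>x\<close> is \<open>{x}\<close>, so a family that
  determines the sections must tell \<open>x\<close> from every other point.\<close>

lemma countably_separated_if_diagonal:
  assumes "Id_on X \<in> prod_sigma X \<E> X \<C>" and "\<And>C. C \<in> \<C> \<Longrightarrow> X - C \<in> \<C>"
  shows "countably_separated X \<C>"
proof -
  obtain \<A> where \<A>: "countable \<A>" "\<A> \<subseteq> \<C>"
    and dep: "\<forall>x\<in>X. \<forall>y\<in>X. \<forall>z\<in>X. (\<forall>A\<in>\<A>. y \<in> A \<longleftrightarrow> z \<in> A) \<longrightarrow>
      ((x, y) \<in> Id_on X \<longleftrightarrow> (x, z) \<in> Id_on X)"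
    using prod_sigma_countable_dependence[OF assms(1)] by (elim exE conjE)
  \<comment> \<open>A separator is directed: some member must contain \<open>x\<close> and miss
    \<open>y\<close>. If \<open>A\<close> contains only \<open>y\<close>, then \<open>X - A\<close>
    does this.\<close>
  have "countable_separator X \<C> (\<A> \<union> (\<lambda>A. X - A) ` \<A>)"
    unfolding countable_separator_def
  proof (intro conjI ballI impI)
    show "countable (\<A> \<union> (\<lambda>A. X - A) ` \<A>)" using \<A>(1) by simp
    show "\<A> \<union> (\<lambda>A. X - A) ` \<A> \<subseteq> \<C>" using \<A>(2) assms(2) by blast
    fix x y
    assume xy: "x \<in> X" "y \<in> X" "x \<noteq> y"
    \<comment> \<open>In the section at \<open>x\<close>, \<open>(x, x)\<close> is on the diagonal
      and \<open>(x, y)\<close> is not.\<close>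
    then have "\<not> (\<forall>A\<in>\<A>. x \<in> A \<longleftrightarrow> y \<in> A)"
      using dep[rule_format, of x x y] by (auto simp: Id_on_iff)
    then obtain A where "A \<in> \<A>" "x \<in> A \<longleftrightarrow> y \<notin> A" by blast
    then show "\<exists>A\<in>\<A> \<union> (\<lambda>A. X - A) ` \<A>. x \<in> A \<and> y \<notin> A"
      using xy by blast
  qed
  then show ?thesis unfolding countably_separated_def by blast
qed

theorem theorem3p4:
  fixes X :: "'a set" and \<B> \<D> :: "'a set set"
  assumes "uncountable X"
    and "sigma_algebra X \<B>" and "sigma_algebra X \<D>"
    and "countably_separated X \<B>" and "countably_separated X \<D>"
    and "\<not> countably_separated X (\<B> \<inter> \<D>)"
  shows "prod_sigma X (join_sigma X \<D> \<B>) X \<B> \<inter> prod_sigma X (join_sigma X \<D> \<B>) X \<D>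
         \<noteq> prod_sigma X (join_sigma X \<D> \<B>) X (\<D> \<inter> \<B>)"
proof
  assume eq: "prod_sigma X (join_sigma X \<D> \<B>) X \<B> \<inter> prod_sigma X (join_sigma X \<D> \<B>) X \<D>
    = prod_sigma X (join_sigma X \<D> \<B>) X (\<D> \<inter> \<B>)"
  interpret \<B>: sigma_algebra X \<B> by fact
  interpret \<D>: sigma_algebra X \<D> by fact
  \<comment> \<open>These inclusions put the diagonal in both products on the left, and the assumed
    equality moves it to the right.\<close>
  have "\<B> \<subseteq> join_sigma X \<D> \<B>" "\<D> \<subseteq> join_sigma X \<D> \<B>"
    unfolding join_sigma_def by (auto intro: sigma_sets.Basic)
  then have "Id_on X \<in> prod_sigma X (join_sigma X \<D> \<B>) X (\<D> \<inter> \<B>)"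
    using assms by (simp add: eq[symmetric] diagonal_in_prod_sigma)
  then have "countably_separated X (\<D> \<inter> \<B>)"
    by (rule countably_separated_if_diagonal) blast
  with assms(6) show False by (simp add: Int_commute)
qed

end
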